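(* Let $\mathcal I\subseteq\mathbb R$ be an interval, let $(Q_\nu)_{\nu\in\mathcal I}$ be a family of probability measures on $\mathbb N_0$ with common support $S\subseteq\mathbb N_0$, with $q_\nu(n)=Q_\nu(\{n\})>0$ for $n\in S$ and $\nu\mapsto q_\nu(n)$ differentiable on $\mathcal I$ for every $n\in S$. Suppose that $q_\nu(n)=w_n(\nu)/A(\nu)$, where $w_n(\nu)>0$ for $n\in S$, $w_n$ and $A$ are differentiable on $\mathcal I$, $A(\nu)=\sum_{n\in S}w_n(\nu)$, and $\partial_\nu A(\nu)=\sum_{n\in S}\partial_\nu w_n(\nu)$ (an absolutely convergent sum). Set $\mathcal G_\nu(n)=\partial_\nu\log w_n(\nu)$. Let $F$ be a fixed PF$_2$ probability measure on $\mathbb N=\{1,2,\dots\}$, and let $C_\nu$ be the compound law with counting law $Q_\nu$ and summand law $F$. (i) If $n\mapsto\mathcal G_\nu(n)$ is nondecreasing on $S$ for every $\nu\in\mathcal I$, then $C_{\nu_1}\le_{\mathrm{lr}}C_{\nu_2}$ for all $\nu_1\le\nu_2$ in $\mathcal I$. (ii) If $n\mapsto\mathcal G_\nu(n)$ is nonincreasing on $S$ for every $\nu\in\mathcal I$, then $C_{\nu_2}\le_{\mathrm{lr}}C_{\nu_1}$ for all $\nu_1\le\nu_2$ in $\mathcal I$.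
   Context: $\mathbb N_0=\{0\}\cup\mathbb N$. Convolution powers: $F^{*0}=\delta_0$ (unit mass at $0$) and $F^{*n}=F^{*(n-1)}*F$ for $n\ge1$. Compound law. For a counting law $Q_\nu$ on $\mathbb N_0$ and a summand law $F$ on $\mathbb N$, let $N$ have law $Q_\nu$ and let $(J_i)_{i\ge1}$ be i.i.d. with law $F$, independent of $N$. Set $X=\sum_{i=1}^N J_i$ (with $X=0$ if $N=0$). $C_\nu$ is the law of $X$, with mass function $f_\nu(k)=\sum_{n\in S}q_\nu(n)F^{*n}(\{k\})$; its support does not depend on $\nu$. PF$_2$: a sequence $(b_k)_{k\in\mathbb Z}$ is PF$_2$ if $b_k\ge0$ for all $k$, the support $\{k:b_k>0\}$ is an interval in $\mathbb Z$, and $b$ is log-concave on its support, i.e. $\log b_{k+2}-2\log b_{k+1}+\log b_k\le0$ whenever $k,k+1,k+2$ lie in the support. A probability distribution on $\mathbb N_0$ is PF$_2$ if its mass sequence, extended by zero outside its support, is PF$_2$. Likelihood-ratio order: for probability measures $P,Q$ on $\mathbb N_0$ with the same support and mass functions $f_P,f_Q$, $P\le_{\mathrm{lr}}Q$ means $k\mapsto f_P(k)/f_Q(k)$ is nonincreasing on the common support. *)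

theory Defs
  imports "HOL-Probability.Probability"
begin

text \<open>Probability measures on the natural numbers (with 0) are rendered as \<^typ>\<open>nat pmf\<close>; the
  support of \<open>P\<close> is \<^term>\<open>set_pmf P\<close> and its mass function is \<^term>\<open>pmf P\<close>.\<close>

definition conv_pmf :: "nat pmf \<Rightarrow> nat pmf \<Rightarrow> nat pmf" where
  "conv_pmf P Q = map_pmf (\<lambda>(x, y). x + y) (pair_pmf P Q)"

primrec conv_power :: "nat pmf \<Rightarrow> nat \<Rightarrow> nat pmf" where
  "conv_power F 0 = return_pmf 0"
| "conv_power F (Suc n) = conv_pmf (conv_power F n) F"

text \<open>The law of the random sum \<open>J\<^sub>1 + \<dots> + J\<^sub>N\<close>, where \<open>N\<close> has law \<open>Q\<close> and the \<open>J\<^sub>i\<close>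
  are i.i.d. with law \<open>F\<close> and independent of \<open>N\<close>: given \<open>N = n\<close>, the sum has law \<open>F\<^sup>*\<^sup>n\<close>.
  The two lemmas below give the description by i.i.d. summands and the mass function.\<close>

definition compound_pmf :: "nat pmf \<Rightarrow> nat pmf \<Rightarrow> nat pmf" where
  "compound_pmf Q F = bind_pmf Q (conv_power F)"

lemma conv_power_eq_iid_sum:
  "conv_power F n = map_pmf sum_list (replicate_pmf n F)"
proof (induction n)
  case (Suc n)
  have "conv_power F (Suc n) =
      bind_pmf (replicate_pmf n F) (\<lambda>xs. bind_pmf F (\<lambda>y. return_pmf (sum_list xs + y)))"
    by (simp add: Suc conv_pmf_def pair_pmf_def map_bind_pmf bind_map_pmf)
  also have "\<dots> = bind_pmf F (\<lambda>y. bind_pmf (replicate_pmf n F) (\<lambda>xs. return_pmf (sum_list xs + y)))"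
    by (rule bind_commute_pmf)
  also have "\<dots> = map_pmf sum_list (replicate_pmf (Suc n) F)"
    by (simp add: map_bind_pmf add.commute)
  finally show ?case .
qed simp

lemma pmf_compound_pmf:
  "((\<lambda>n. pmf Q n * pmf (conv_power F n) k) has_sum pmf (compound_pmf Q F) k) (set_pmf Q)"
proof -
  have "Infinite_Set_Sum.abs_summable_on (\<lambda>n. pmf Q n * pmf (conv_power F n) k) UNIV"
  proof (rule Infinite_Set_Sum.abs_summable_on_comparison_test)
    show "Infinite_Set_Sum.abs_summable_on (pmf Q) UNIV"
      by (rule pmf_abs_summable)
    show "norm (pmf Q n * pmf (conv_power F n) k) \<le> norm (pmf Q n)" for n
      by (simp add: abs_mult mult_left_le pmf_le_1)
  qed
  moreover have "pmf (compound_pmf Q F) k = infsetsum (\<lambda>n. pmf Q n * pmf (conv_power F n) k) UNIV"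
    by (simp add: compound_pmf_def pmf_bind pmf_expectation_eq_infsetsum)
  ultimately have "((\<lambda>n. pmf Q n * pmf (conv_power F n) k) has_sum pmf (compound_pmf Q F) k) UNIV"
    by (metis abs_summable_equivalent abs_summable_summable has_sum_infsum infsetsum_infsum)
  then show ?thesis
    by (subst has_sum_cong_neutral[where T = UNIV]) (auto simp: set_pmf_iff)
qed

definition PF2_seq :: "(int \<Rightarrow> real) \<Rightarrow> bool" where
  "PF2_seq b \<longleftrightarrow>
     (\<forall>k. b k \<ge> 0) \<and>
     (\<forall>i j k. i \<le> j \<and> j \<le> k \<and> b i > 0 \<and> b k > 0 \<longrightarrow> b j > 0) \<and>
     (\<forall>k. b k > 0 \<and> b (k + 1) > 0 \<and> b (k + 2) > 0 \<longrightarrow>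
        ln (b (k + 2)) - 2 * ln (b (k + 1)) + ln (b k) \<le> 0)"

definition PF2_pmf :: "nat pmf \<Rightarrow> bool" where
  "PF2_pmf P \<longleftrightarrow> PF2_seq (\<lambda>k. if k \<ge> 0 then pmf P (nat k) else 0)"

text \<open>The likelihood-ratio order is only considered for laws with the same support; this is part
  of the definition here.\<close>

definition lr_le :: "nat pmf \<Rightarrow> nat pmf \<Rightarrow> bool" (infix "\<le>\<^sub>l\<^sub>r" 50) where
  "P \<le>\<^sub>l\<^sub>r Q \<longleftrightarrow>
     set_pmf P = set_pmf Q \<and> antimono_on (set_pmf P) (\<lambda>k. pmf P k / pmf Q k)"

text \<open>The derivative of \<open>f\<close> on an interval \<open>I\<close>, one-sided at end points belonging to \<open>I\<close>.
  If \<open>I\<close> is a single point the value is unspecified.\<close>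

definition deriv_on :: "real set \<Rightarrow> (real \<Rightarrow> real) \<Rightarrow> real \<Rightarrow> real" where
  "deriv_on I f x = vector_derivative f (at x within I)"

definition score :: "real set \<Rightarrow> (nat \<Rightarrow> real \<Rightarrow> real) \<Rightarrow> real \<Rightarrow> nat \<Rightarrow> real" where
  "score I w \<nu> n = deriv_on I (\<lambda>t. ln (w n t)) \<nu>"

end

theory Submission
  imports Defs
begin

text \<open>
  The compound law is a mixture of the convolution powers of \<open>F\<close>, so the claim is preservation of
  the likelihood-ratio order by the kernel \<open>(n, k) \<mapsto> F\<^sup>*\<^sup>n({k})\<close>. Everything is phrased through
  \<open>2 \<times> 2\<close> minors: \<open>a\<close> precedes \<open>b\<close> when \<open>a n * b m \<le> a m * b n\<close> for \<open>m \<le> n\<close>. Unlike a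
  quotient, this form stays meaningful where mass functions vanish, as those of the convolution
  powers do at different places.

  The tool is the Cauchy--Binet formula for minors of order two: the difference
  \<open>(\<Sum>n. a1 n * b1 n) * (\<Sum>n. a2 n * b2 n) - (\<Sum>n. a1 n * b2 n) * (\<Sum>n. a2 n * b1 n)\<close> is half the
  sum over all \<open>m, n\<close> of \<open>(a1 m * a2 n - a1 n * a2 m) * (b1 m * b2 n - b1 n * b2 m)\<close>, hence is
  nonnegative once \<open>a1\<close> precedes \<open>a2\<close> and \<open>b1\<close> precedes \<open>b2\<close> (\<open>minor_le_has_sum\<close>). Summed over the
  count \<open>n\<close>, it reduces the claim to two orderings.

  \<^item> The kernel has nonnegative minors (\<open>conv_power_minor_le\<close>): a PF\<open>\<^sub>2\<close> sequence has a Toeplitz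
    matrix with nonnegative minors, this property survives convolution, again by Cauchy--Binet, and
    for \<open>n \<le> n'\<close> the \<open>n'\<close>-th convolution power is a mixture of right shifts of the \<open>n\<close>-th, each of
    which lies above the \<open>n\<close>-th power itself.

  \<^item> The counting laws are ordered (\<open>weight_ratio_mono\<close>): a score that is monotone in \<open>n\<close> says that
    \<open>ln (w n \<nu>) - ln (w m \<nu>)\<close> is monotone in \<open>\<nu>\<close>, and the normalising factor \<open>A\<close> cancels from the
    minors.

  Parts (i) and (ii) differ only in which of \<open>\<nu>1, \<nu>2\<close> indexes the smaller law.
\<close>

section \<open>Nonnegative minors and Cauchy--Binet\<close>

definition minor_le :: "nat set \<Rightarrow> (nat \<Rightarrow> real) \<Rightarrow> (nat \<Rightarrow> real) \<Rightarrow> bool" where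
  "minor_le S a b \<longleftrightarrow> (\<forall>m\<in>S. \<forall>n\<in>S. m \<le> n \<longrightarrow> a n * b m \<le> a m * b n)"

lemma minor_leD: "minor_le S a b \<Longrightarrow> m \<in> S \<Longrightarrow> n \<in> S \<Longrightarrow> m \<le> n \<Longrightarrow> a n * b m \<le> a m * b n"
  by (auto simp: minor_le_def)

text \<open>The summand of the symmetrised double sum is a product of two minors, and exchanging \<open>m\<close> and
  \<open>n\<close> flips the sign of both, so each summand is nonnegative.\<close>

lemma minor_le_sum:
  assumes a: "minor_le S a1 a2" and b: "minor_le S b1 b2" and "T \<subseteq> S"
  shows "(\<Sum>n\<in>T. a1 n * b2 n) * (\<Sum>n\<in>T. a2 n * b1 n) \<le>
         (\<Sum>n\<in>T. a1 n * b1 n) * (\<Sum>n\<in>T. a2 n * b2 n)"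
proof -
  define g where "g m n = a1 m * b1 m * (a2 n * b2 n) - a1 m * b2 m * (a2 n * b1 n)" for m n
  have "0 \<le> g m n + g n m" if "m \<in> T" "n \<in> T" for m n
  proof -
    have "g m n + g n m = (a1 m * a2 n - a1 n * a2 m) * (b1 m * b2 n - b1 n * b2 m)"
      by (simp add: g_def algebra_simps)
    moreover have "0 \<le> \<dots>"
    proof (cases "m \<le> n")
      case True
      with that \<open>T \<subseteq> S\<close> minor_leD[OF a, of m n] minor_leD[OF b, of m n] show ?thesis
        by (intro mult_nonneg_nonneg) auto
    next
      case False
      with that \<open>T \<subseteq> S\<close> minor_leD[OF a, of n m] minor_leD[OF b, of n m] show ?thesis
        by (intro mult_nonpos_nonpos) auto
    qed
    ultimately show ?thesis by simp
  qed
  then have "0 \<le> (\<Sum>m\<in>T. \<Sum>n\<in>T. g m n + g n m)"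
    by (intro sum_nonneg) auto
  also have "\<dots> = (\<Sum>m\<in>T. \<Sum>n\<in>T. g m n) + (\<Sum>m\<in>T. \<Sum>n\<in>T. g n m)"
    by (simp add: sum.distrib)
  also have "(\<Sum>m\<in>T. \<Sum>n\<in>T. g n m) = (\<Sum>m\<in>T. \<Sum>n\<in>T. g m n)"
    by (rule sum.swap)
  finally have "0 \<le> (\<Sum>m\<in>T. \<Sum>n\<in>T. g m n)" by simp
  also have "\<dots> = (\<Sum>n\<in>T. a1 n * b1 n) * (\<Sum>n\<in>T. a2 n * b2 n) -
                 (\<Sum>n\<in>T. a1 n * b2 n) * (\<Sum>n\<in>T. a2 n * b1 n)"
    by (simp add: g_def sum_subtractf sum_product)
  finally show ?thesis by simp
qed

text \<open>For infinite \<open>S\<close> the finite inequality passes to the limit along finite subsets.\<close>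

lemma minor_le_has_sum:
  assumes "minor_le S a1 a2" and "minor_le S b1 b2"
    and "((\<lambda>n. a1 n * b1 n) has_sum x11) S" and "((\<lambda>n. a1 n * b2 n) has_sum x12) S"
    and "((\<lambda>n. a2 n * b1 n) has_sum x21) S" and "((\<lambda>n. a2 n * b2 n) has_sum x22) S"
  shows "x12 * x21 \<le> x11 * x22"
proof (rule tendsto_le)
  show "((\<lambda>T. (\<Sum>n\<in>T. a1 n * b1 n) * (\<Sum>n\<in>T. a2 n * b2 n)) \<longlongrightarrow> x11 * x22)
          (finite_subsets_at_top S)"
    and "((\<lambda>T. (\<Sum>n\<in>T. a1 n * b2 n) * (\<Sum>n\<in>T. a2 n * b1 n)) \<longlongrightarrow> x12 * x21)
          (finite_subsets_at_top S)"
    using assms(3-6) by (auto simp: has_sum_def intro!: tendsto_mult)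
  show "\<forall>\<^sub>F T in finite_subsets_at_top S. (\<Sum>n\<in>T. a1 n * b2 n) * (\<Sum>n\<in>T. a2 n * b1 n) \<le>
          (\<Sum>n\<in>T. a1 n * b1 n) * (\<Sum>n\<in>T. a2 n * b2 n)"
    using minor_le_sum[OF assms(1,2)] by (intro eventually_finite_subsets_at_top_weakI) auto
qed simp

section \<open>Toeplitz matrices of PF\<open>\<^sub>2\<close> sequences\<close>

text \<open>The guard extends \<open>f\<close> by zero to negative arguments.\<close>

definition toeplitz :: "(nat \<Rightarrow> real) \<Rightarrow> nat \<Rightarrow> nat \<Rightarrow> real" where
  "toeplitz f i j = (if j \<le> i then f (i - j) else 0)"

definition tp2_toeplitz :: "(nat \<Rightarrow> real) \<Rightarrow> bool" where
  "tp2_toeplitz f \<longleftrightarrow> (\<forall>i i'. i \<le> i' \<longrightarrow> minor_le UNIV (toeplitz f i) (toeplitz f i'))"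

lemma tp2_toeplitzD:
  "tp2_toeplitz f \<Longrightarrow> i \<le> i' \<Longrightarrow> j \<le> j' \<Longrightarrow>
    toeplitz f i j' * toeplitz f i' j \<le> toeplitz f i j * toeplitz f i' j'"
  by (auto simp: tp2_toeplitz_def minor_le_def)

text \<open>Interval support lets the three-point log-concavity inequality be chained: where the left-hand
  side is nonzero, all values in between are positive, so one may divide by them.\<close>

lemma PF2_pmf_four_point:
  assumes "PF2_pmf P"
  shows "pmf P i * pmf P (i + j + d) \<le> pmf P (i + j) * pmf P (i + d)"
proof -
  let ?f = "pmf P"
  define b where "b k = (if k \<ge> 0 then ?f (nat k) else 0)" for k :: int
  have b: "PF2_seq b"
    using assms unfolding PF2_pmf_def b_def[abs_def] .
  have b_int: "b (int k) = ?f k" "b (int k + 1) = ?f (k + 1)" "b (int k + 2) = ?f (k + 2)" for k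
    by (simp_all add: b_def nat_add_distrib)
  have pos: "?f l > 0" if "?f k > 0" "?f m > 0" "k \<le> l" "l \<le> m" for k l m
  proof -
    have "b i > 0 \<Longrightarrow> b j > 0 \<Longrightarrow> i \<le> h \<Longrightarrow> h \<le> j \<Longrightarrow> b h > 0" for i h j
      using b unfolding PF2_seq_def by blast
    from this[of "int k" "int m" "int l"] that show ?thesis by (simp add: b_int)
  qed
  have three: "?f k * ?f (k + 2) \<le> ?f (k + 1) * ?f (k + 1)"
    if k: "?f k > 0" "?f (k + 1) > 0" "?f (k + 2) > 0" for k
  proof -
    have "b i > 0 \<Longrightarrow> b (i + 1) > 0 \<Longrightarrow> b (i + 2) > 0 \<Longrightarrow>
        ln (b (i + 2)) - 2 * ln (b (i + 1)) + ln (b i) \<le> 0" for i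
      using b unfolding PF2_seq_def by blast
    from this[of "int k"] k
    have "ln (?f (k + 2)) - 2 * ln (?f (k + 1)) + ln (?f k) \<le> 0"
      by (simp only: b_int)
    then have "ln (?f k * ?f (k + 2)) \<le> ln (?f (k + 1) * ?f (k + 1))"
      using k by (simp only: ln_mult_pos)
    then show ?thesis
      using k by (subst (asm) ln_le_cancel_iff) (simp_all only: mult_pos_pos)
  qed
  have step: "?f i * ?f (i + 1 + d) \<le> ?f (i + 1) * ?f (i + d)"
    if "?f i > 0" "?f (i + 1 + d) > 0" for i d
    using that
  proof (induction d)
    case (Suc d)
    have p: "?f (i + d) > 0" "?f (i + d + 1) > 0" "?f (i + d + 2) > 0"
      using pos[OF Suc.prems, of "i + d"] pos[OF Suc.prems, of "i + d + 1"] Suc.prems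
      by (auto simp: numeral_2_eq_2)
    have "?f i * ?f (i + d + 2) * ?f (i + d) \<le> ?f i * (?f (i + d + 1) * ?f (i + d + 1))"
      using mult_left_mono[OF three[OF p], of "?f i"] by (simp add: ac_simps)
    also have "\<dots> \<le> (?f (i + 1) * ?f (i + d)) * ?f (i + d + 1)"
      using mult_right_mono[OF Suc.IH, of "?f (i + d + 1)"] Suc.prems p by (simp add: ac_simps)
    finally have "(?f i * ?f (i + d + 2)) * ?f (i + d) \<le> (?f (i + 1) * ?f (i + d + 1)) * ?f (i + d)"
      by (simp add: ac_simps)
    then have "?f i * ?f (i + d + 2) \<le> ?f (i + 1) * ?f (i + d + 1)"
      using p by (metis mult_le_cancel_right_pos)
    then show ?case by (simp add: numeral_2_eq_2)
  qed simp
  have "?f i * ?f (i + j + d) \<le> ?f (i + j) * ?f (i + d)"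
    if "?f i > 0" "?f (i + j + d) > 0"
    using that
  proof (induction j)
    case (Suc j)
    have p: "?f (i + j) > 0" "?f (i + j + d) > 0" "?f (i + j + 1 + d) > 0"
      using pos[OF Suc.prems, of "i + j"] pos[OF Suc.prems, of "i + j + d"] Suc.prems by auto
    have "?f i * ?f (i + j + 1 + d) * ?f (i + j) \<le> ?f i * (?f (i + j + 1) * ?f (i + j + d))"
      using mult_left_mono[OF step[OF p(1,3)], of "?f i"] by (simp add: ac_simps)
    also have "\<dots> \<le> (?f (i + j) * ?f (i + d)) * ?f (i + j + 1)"
      using mult_right_mono[OF Suc.IH, of "?f (i + j + 1)"] Suc.prems p by (simp add: ac_simps)
    finally have "(?f i * ?f (i + j + 1 + d)) * ?f (i + j) \<le> (?f (i + j + 1) * ?f (i + d)) * ?f (i + j)"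
      by (simp add: ac_simps)
    then have "?f i * ?f (i + j + 1 + d) \<le> ?f (i + j + 1) * ?f (i + d)"
      using p by (metis mult_le_cancel_right_pos)
    then show ?case by simp
  qed simp
  then show ?thesis
    by (cases "?f i > 0 \<and> ?f (i + j + d) > 0") (auto simp: pmf_positive_iff set_pmf_iff)
qed

lemma tp2_toeplitz_PF2:
  assumes "PF2_pmf P"
  shows "tp2_toeplitz (pmf P)"
  unfolding tp2_toeplitz_def minor_le_def
proof (intro allI ballI impI)
  fix i i' j j' :: nat
  assume ij: "i \<le> i'" "j \<le> j'"
  show "toeplitz (pmf P) i j' * toeplitz (pmf P) i' j \<le> toeplitz (pmf P) i j * toeplitz (pmf P) i' j'"
  proof (cases "j' \<le> i")
    case True
    from PF2_pmf_four_point[OF assms, of "i - j'" "j' - j" "i' - i"] True ij show ?thesis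
      by (simp add: toeplitz_def)
  next
    case False
    then show ?thesis by (simp add: toeplitz_def)
  qed
qed

section \<open>Convolution powers\<close>

lemma pmf_conv_pmf: "pmf (conv_pmf P R) k = (\<Sum>l\<le>k. pmf P (k - l) * pmf R l)"
proof -
  have inj: "inj_on (\<lambda>l. (k - l, l)) {..k}" by (auto simp: inj_on_def)
  have "(\<lambda>(x, y). x + y) -` {k} = (\<lambda>l. (k - l, l)) ` {..k}" by (auto simp: image_iff)
  then have "pmf (conv_pmf P R) k = measure (measure_pmf (pair_pmf P R)) ((\<lambda>l. (k - l, l)) ` {..k})"
    by (simp add: conv_pmf_def pmf_map)
  also have "\<dots> = (\<Sum>l\<le>k. pmf P (k - l) * pmf R l)"
    by (simp add: measure_measure_pmf_finite sum.reindex[OF inj] pmf_pair)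
  finally show ?thesis .
qed

lemma pmf_conv_pmf_toeplitz:
  assumes "k \<le> N"
  shows "pmf (conv_pmf P R) k = (\<Sum>l\<le>N. toeplitz (pmf P) k l * pmf R l)"
  unfolding pmf_conv_pmf toeplitz_def using assms
  by (intro sum.mono_neutral_cong_left) auto

text \<open>Convolution of sequences is multiplication of Toeplitz matrices.\<close>

lemma toeplitz_conv_pmf:
  assumes "i \<le> N"
  shows "toeplitz (pmf (conv_pmf P R)) i j = (\<Sum>l\<le>N. toeplitz (pmf P) i l * toeplitz (pmf R) l j)"
proof (cases "j \<le> i")
  case True
  have "toeplitz (pmf (conv_pmf P R)) i j = (\<Sum>l\<le>i - j. pmf P (i - j - l) * pmf R l)"
    using True by (simp add: toeplitz_def pmf_conv_pmf)
  also have "\<dots> = (\<Sum>l\<in>{j..i}. pmf P (i - l) * pmf R (l - j))"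
    using True by (intro sum.reindex_bij_witness[where j = "\<lambda>l. l + j" and i = "\<lambda>l. l - j"])
      (auto simp: diff_diff_left add.commute)
  also have "\<dots> = (\<Sum>l\<le>N. toeplitz (pmf P) i l * toeplitz (pmf R) l j)"
    using assms by (intro sum.mono_neutral_cong_left) (auto simp: toeplitz_def)
  finally show ?thesis .
next
  case False
  then show ?thesis by (auto simp: toeplitz_def intro!: sum.neutral)
qed

text \<open>The rows of the first matrix are ordered by hypothesis, and so are the columns of the second,
  because a minor is unchanged by transposition.\<close>

lemma tp2_toeplitz_conv:
  assumes P: "tp2_toeplitz (pmf P)" and R: "tp2_toeplitz (pmf R)"
  shows "tp2_toeplitz (pmf (conv_pmf P R))"
  unfolding tp2_toeplitz_def minor_le_def
proof (intro allI ballI impI)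
  fix i i' j j' :: nat
  assume ij: "i \<le> i'" "j \<le> j'"
  have a: "minor_le UNIV (toeplitz (pmf P) i) (toeplitz (pmf P) i')"
    using P ij by (auto simp: tp2_toeplitz_def)
  have b: "minor_le UNIV (\<lambda>l. toeplitz (pmf R) l j) (\<lambda>l. toeplitz (pmf R) l j')"
    using tp2_toeplitzD[OF R _ ij(2)] by (auto simp: minor_le_def mult.commute)
  show "toeplitz (pmf (conv_pmf P R)) i j' * toeplitz (pmf (conv_pmf P R)) i' j
      \<le> toeplitz (pmf (conv_pmf P R)) i j * toeplitz (pmf (conv_pmf P R)) i' j'"
    using minor_le_sum[OF a b, of "{..i'}"] ij by (simp add: toeplitz_conv_pmf[of _ i'])
qed

lemma tp2_toeplitz_conv_power:
  assumes "PF2_pmf F"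
  shows "tp2_toeplitz (pmf (conv_power F n))"
proof (induction n)
  case 0
  show ?case by (auto simp: tp2_toeplitz_def minor_le_def toeplitz_def indicator_def)
next
  case (Suc n)
  with tp2_toeplitz_PF2[OF assms] show ?case by (simp add: tp2_toeplitz_conv)
qed

lemma conv_pmf_eq_bind: "conv_pmf P R = bind_pmf P (\<lambda>x. bind_pmf R (\<lambda>y. return_pmf (x + y)))"
  by (simp add: conv_pmf_def pair_pmf_def map_bind_pmf)

lemma conv_pmf_assoc: "conv_pmf (conv_pmf P R) T = conv_pmf P (conv_pmf R T)"
  by (simp add: conv_pmf_eq_bind bind_assoc_pmf bind_return_pmf add.assoc)

lemma conv_power_add: "conv_power F (n + m) = conv_pmf (conv_power F n) (conv_power F m)"
proof (induction m)
  case 0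
  show ?case by (simp add: conv_pmf_eq_bind bind_return_pmf bind_return_pmf')
qed (simp add: conv_pmf_assoc)

text \<open>Writing the \<open>n'\<close>-th power as the \<open>n\<close>-th convolved with the \<open>(n' - n)\<close>-th makes the minor a
  nonnegative combination of Toeplitz minors of the \<open>n\<close>-th power whose smaller column index is
  \<open>0\<close>. Going from \<open>n\<close> to \<open>n'\<close> directly, instead of one step at a time, matters because
  \<open>minor_le\<close> is not transitive when mass functions vanish.\<close>

lemma conv_power_minor_le:
  assumes F: "PF2_pmf F" and "n \<le> n'"
  shows "minor_le UNIV (pmf (conv_power F n)) (pmf (conv_power F n'))"
  unfolding minor_le_def
proof (intro ballI impI)
  fix k k' :: nat
  assume k: "k \<le> k'"
  let ?f = "pmf (conv_power F n)" and ?g = "pmf (conv_power F (n' - n))"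
  have n': "pmf (conv_power F n') i = (\<Sum>l\<le>k'. toeplitz ?f i l * ?g l)" if "i \<le> k'" for i
    using conv_power_add[of F n "n' - n"] \<open>n \<le> n'\<close> pmf_conv_pmf_toeplitz[OF that] by simp
  have "?f k' * pmf (conv_power F n') k = (\<Sum>l\<le>k'. (toeplitz ?f k l * ?f k') * ?g l)"
    by (simp add: n'[OF k] sum_distrib_left ac_simps)
  also have "\<dots> \<le> (\<Sum>l\<le>k'. (?f k * toeplitz ?f k' l) * ?g l)"
  proof (intro sum_mono mult_right_mono)
    fix l
    show "toeplitz ?f k l * ?f k' \<le> ?f k * toeplitz ?f k' l"
      using tp2_toeplitzD[OF tp2_toeplitz_conv_power[OF F] k, of 0 l n] by (simp add: toeplitz_def)
  qed simp
  also have "\<dots> = ?f k * pmf (conv_power F n') k'"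
    by (simp add: n' sum_distrib_left ac_simps)
  finally show "?f k' * pmf (conv_power F n') k \<le> ?f k * pmf (conv_power F n') k'" .
qed

section \<open>Ordered counting laws give ordered compound laws\<close>

text \<open>The mass of the compound law at \<open>k\<close> is the counting law paired with the column
  \<open>n \<mapsto> pmf (conv_power F n) k\<close>, so Cauchy--Binet is applied with two counting laws and two
  columns.\<close>

lemma compound_pmf_lr_mono:
  assumes F: "PF2_pmf F" and S: "set_pmf Q1 = S" "set_pmf Q2 = S"
    and Q: "minor_le S (pmf Q1) (pmf Q2)"
  shows "compound_pmf Q1 F \<le>\<^sub>l\<^sub>r compound_pmf Q2 F"
proof -
  let ?C1 = "compound_pmf Q1 F" and ?C2 = "compound_pmf Q2 F"
  have supp: "set_pmf ?C1 = set_pmf ?C2"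
    by (simp add: compound_pmf_def S)
  have "pmf ?C1 k' / pmf ?C2 k' \<le> pmf ?C1 k / pmf ?C2 k"
    if k: "k \<in> set_pmf ?C1" "k' \<in> set_pmf ?C1" "k \<le> k'" for k k'
  proof -
    have "minor_le S (\<lambda>n. pmf (conv_power F n) k) (\<lambda>n. pmf (conv_power F n) k')"
      using minor_leD[OF conv_power_minor_le[OF F] _ _ \<open>k \<le> k'\<close>]
      by (auto simp: minor_le_def mult.commute)
    from minor_le_has_sum[OF Q this pmf_compound_pmf[of Q1 F, unfolded S]
        pmf_compound_pmf[of Q1 F, unfolded S] pmf_compound_pmf[of Q2 F, unfolded S]
        pmf_compound_pmf[of Q2 F, unfolded S]]
    have "pmf ?C1 k' * pmf ?C2 k \<le> pmf ?C1 k * pmf ?C2 k'" .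
    moreover have "pmf ?C2 k > 0" "pmf ?C2 k' > 0"
      using k supp by (auto simp: pmf_positive_iff)
    ultimately show ?thesis by (simp add: divide_simps)
  qed
  with supp show ?thesis by (auto simp: lr_le_def monotone_on_def)
qed

section \<open>Monotone scores give ordered counting laws\<close>

text \<open>The difference of the scores at \<open>n\<close> and \<open>m\<close> is the derivative of
  \<open>ln (w n \<nu> / w m \<nu>)\<close>, so by the mean value theorem this ratio of weights increases.
  Nondecreasing scores give this for \<open>m \<le> n\<close>, nonincreasing ones for \<open>n \<le> m\<close>.\<close>

lemma weight_ratio_mono:
  fixes w :: "nat \<Rightarrow> real \<Rightarrow> real"
  assumes I: "is_interval I" "x \<in> I" "y \<in> I" "x \<le> y"
    and diff: "w m differentiable_on I" "w n differentiable_on I"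
    and pos: "\<And>t. t \<in> I \<Longrightarrow> w m t > 0" "\<And>t. t \<in> I \<Longrightarrow> w n t > 0"
    and score: "\<And>t. t \<in> I \<Longrightarrow> score I w t m \<le> score I w t n"
  shows "w n x * w m y \<le> w m x * w n y"
proof -
  have sub: "{x..y} \<subseteq> I"
    using I by (meson atLeastAtMost_iff mem_is_interval_1_I subsetI)
  have der: "((\<lambda>t. ln (w p t)) has_real_derivative score I w t p) (at t within I)"
    if "p \<in> {m, n}" "t \<in> I" for p t
  proof -
    have "w p differentiable (at t within I)" "w p t > 0"
      using that diff pos by (auto simp: differentiable_on_def)
    then obtain D where "(w p has_real_derivative D) (at t within I)"
      by (auto simp: real_differentiable_def)
    then have "((\<lambda>t. ln (w p t)) has_real_derivative (1 / w p t * D)) (at t within I)"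
      using DERIV_chain2[where f = ln and g = "w p", OF DERIV_ln_divide[OF \<open>w p t > 0\<close>]]
      by blast
    then have "(\<lambda>t. ln (w p t)) differentiable (at t within I)"
      by (auto simp: real_differentiable_def)
    then show ?thesis
      by (simp add: score_def deriv_on_def vector_derivative_works
        has_real_derivative_iff_has_vector_derivative)
  qed
  define h where "h t = ln (w n t) - ln (w m t)" for t
  have "h x \<le> h y"
  proof -
    have "(h has_derivative (*) (score I w t n - score I w t m)) (at t within {x..y})"
      if "x \<le> t" "t \<le> y" for t
    proof -
      have "t \<in> I" using that sub by auto
      then have "(h has_real_derivative (score I w t n - score I w t m)) (at t within I)"
        unfolding h_def[abs_def] by (intro DERIV_diff der) auto
      from DERIV_subset[OF this sub] show ?thesis
        by (simp only: has_field_derivative_def)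
    qed
    from mvt_very_simple[OF \<open>x \<le> y\<close> this] obtain t where t: "t \<in> {x..y}"
      "h y - h x = (score I w t n - score I w t m) * (y - x)" by blast
    then have "t \<in> I" using sub by blast
    then have "0 \<le> h y - h x"
      unfolding t(2) using score \<open>x \<le> y\<close> by (intro mult_nonneg_nonneg) auto
    then show ?thesis by simp
  qed
  moreover have "w m x > 0" "w m y > 0" "w n x > 0" "w n y > 0"
    using pos I by auto
  ultimately have "ln (w n x * w m y) \<le> ln (w m x * w n y)"
    by (simp add: h_def ln_mult)
  then show ?thesis
    using \<open>w m x > 0\<close> \<open>w m y > 0\<close> \<open>w n x > 0\<close> \<open>w n y > 0\<close>
    by (subst (asm) ln_le_cancel_iff) auto
qed

theorem proposition3p14:
  fixes I :: "real set" and S :: "nat set"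
    and Q :: "real \<Rightarrow> nat pmf" and F :: "nat pmf"
    and w :: "nat \<Rightarrow> real \<Rightarrow> real" and A :: "real \<Rightarrow> real"
  assumes "is_interval I"
    and "\<And>\<nu>. \<nu> \<in> I \<Longrightarrow> set_pmf (Q \<nu>) = S"
    and "\<And>n. n \<in> S \<Longrightarrow> (\<lambda>\<nu>. pmf (Q \<nu>) n) differentiable_on I"
    and "\<And>\<nu> n. \<nu> \<in> I \<Longrightarrow> n \<in> S \<Longrightarrow> pmf (Q \<nu>) n = w n \<nu> / A \<nu>"
    and "\<And>\<nu> n. \<nu> \<in> I \<Longrightarrow> n \<in> S \<Longrightarrow> w n \<nu> > 0"
    and "\<And>n. n \<in> S \<Longrightarrow> w n differentiable_on I"
    and "A differentiable_on I"
    and "\<And>\<nu>. \<nu> \<in> I \<Longrightarrow> ((\<lambda>n. w n \<nu>) has_sum A \<nu>) S"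
    and "\<And>\<nu>. \<nu> \<in> I \<Longrightarrow> (\<lambda>n. \<bar>deriv_on I (w n) \<nu>\<bar>) summable_on S"
    and "\<And>\<nu>. \<nu> \<in> I \<Longrightarrow> deriv_on I A \<nu> = (\<Sum>\<^sub>\<infinity>n\<in>S. deriv_on I (w n) \<nu>)"
    and "set_pmf F \<subseteq> {1..}"
    and "PF2_pmf F"
  shows "((\<forall>\<nu>\<in>I. mono_on S (score I w \<nu>)) \<longrightarrow>
           (\<forall>\<nu>1\<in>I. \<forall>\<nu>2\<in>I. \<nu>1 \<le> \<nu>2 \<longrightarrow> compound_pmf (Q \<nu>1) F \<le>\<^sub>l\<^sub>r compound_pmf (Q \<nu>2) F)) \<and>
         ((\<forall>\<nu>\<in>I. antimono_on S (score I w \<nu>)) \<longrightarrow>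
           (\<forall>\<nu>1\<in>I. \<forall>\<nu>2\<in>I. \<nu>1 \<le> \<nu>2 \<longrightarrow> compound_pmf (Q \<nu>2) F \<le>\<^sub>l\<^sub>r compound_pmf (Q \<nu>1) F))"
proof -
  have A_pos: "A \<nu> > 0" if \<nu>: "\<nu> \<in> I" for \<nu>
  proof -
    obtain n where n: "n \<in> S" using set_pmf_not_empty[of "Q \<nu>"] assms(2)[OF \<nu>] by blast
    then have "pmf (Q \<nu>) n > 0" using assms(2)[OF \<nu>] by (simp add: pmf_positive_iff)
    with assms(4,5)[OF \<nu> n] show ?thesis by (simp add: zero_less_divide_iff)
  qed
  have lr: "compound_pmf (Q a) F \<le>\<^sub>l\<^sub>r compound_pmf (Q b) F"
    if ab: "a \<in> I" "b \<in> I"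
      and w: "\<And>m n. m \<in> S \<Longrightarrow> n \<in> S \<Longrightarrow> m \<le> n \<Longrightarrow> w n a * w m b \<le> w m a * w n b"
    for a b
  proof (rule compound_pmf_lr_mono[OF \<open>PF2_pmf F\<close> assms(2)[OF ab(1)] assms(2)[OF ab(2)]])
    show "minor_le S (pmf (Q a)) (pmf (Q b))"
      using w A_pos[OF ab(1)] A_pos[OF ab(2)]
      by (auto simp: minor_le_def assms(4) ab intro!: divide_right_mono)
  qed
  show ?thesis
  proof (intro conjI impI ballI)
    fix \<nu>1 \<nu>2
    assume mono: "\<forall>\<nu>\<in>I. mono_on S (score I w \<nu>)" and \<nu>: "\<nu>1 \<in> I" "\<nu>2 \<in> I" "\<nu>1 \<le> \<nu>2"
    show "compound_pmf (Q \<nu>1) F \<le>\<^sub>l\<^sub>r compound_pmf (Q \<nu>2) F"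
    proof (rule lr[OF \<nu>(1,2)])
      fix m n assume mn: "m \<in> S" "n \<in> S" "m \<le> n"
      show "w n \<nu>1 * w m \<nu>2 \<le> w m \<nu>1 * w n \<nu>2"
        using mono mn assms(5,6)
        by (intro weight_ratio_mono[OF \<open>is_interval I\<close> \<nu>]) (auto simp: monotone_on_def)
    qed
  next
    fix \<nu>1 \<nu>2
    assume anti: "\<forall>\<nu>\<in>I. antimono_on S (score I w \<nu>)" and \<nu>: "\<nu>1 \<in> I" "\<nu>2 \<in> I" "\<nu>1 \<le> \<nu>2"
    show "compound_pmf (Q \<nu>2) F \<le>\<^sub>l\<^sub>r compound_pmf (Q \<nu>1) F"
    proof (rule lr[OF \<nu>(2,1)])
      fix m n assume mn: "m \<in> S" "n \<in> S" "m \<le> n"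
      have "w m \<nu>1 * w n \<nu>2 \<le> w n \<nu>1 * w m \<nu>2"
        using anti mn assms(5,6)
        by (intro weight_ratio_mono[OF \<open>is_interval I\<close> \<nu>]) (auto simp: monotone_on_def)
      then show "w n \<nu>2 * w m \<nu>1 \<le> w m \<nu>2 * w n \<nu>1" by (simp add: mult.commute)
    qed
  qed
qed

end
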